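(* Let $n\geq 3$ and $3\leq k\leq n$. Let $U_1,\dots,U_n$ be independent random variables, each uniformly distributed on $[0,1]$ (interpreted as lengths of $n$ sticks). Say that a $k$-gon can be constructed from these lengths if there exist $k$ distinct indices among $\{1,\dots,n\}$ such that the largest of the corresponding $k$ lengths is less than the sum of the other $k-1$ of them. For $1\leq \ell\leq k-1$, let $T_{k,\ell}$ be the $(k-1)$-bonacci sequence with initial terms \[ T_{k,\ell}(1)=\cdots=T_{k,\ell}(\ell-1)=0,\qquad T_{k,\ell}(\ell)=\cdots=T_{k,\ell}(k-1)=1 . \] Then the probability $p_{n,k}$ that no $k$-gon can be constructed from the $n$ lengths is \[ p_{n,k}=\frac{1}{\prod_{\ell=1}^{k-1}T_{k,\ell}(n)\cdot\prod_{i=1}^{n-k+1}T_{k,k-1}(n-i)} . \] Moreover, letting $S_k$ be the $(k-1)$-bonacci sequence with initial terms $S_k(1)=1$ and $S_k(i)=2^{i-2}$ for $2\leq i\leq k-1$, one has equivalently \[ p_{n,k}=\frac{1}{\prod_{\ell=1}^{k-3}T_{k,\ell}(n)\cdot\prod_{i=1}^{n-k+3}S_k(i)} , \] where an empty product equals $1$.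
   Context: A $(k-1)$-bonacci sequence $(a(i))_{i\geq 1}$ is a sequence determined by its initial terms $a(1),\dots,a(k-1)$ and the recurrence $a(i)=\sum_{j=1}^{k-1}a(i-j)$ for all $i\geq k$ (each term is the sum of the preceding $k-1$ terms). For $k=3$ these are Fibonacci-type sequences. *)

theory Defs
  imports "HOL-Probability.Probability"
begin

text \<open>Sequences are indexed from 1, as in \<open>(a(i))\<^bsub>i \<ge> 1\<^esub>\<close>: the values \<open>a 1, \<dots>, a m\<close> are
  the initial terms, and the value at index 0 is a dummy that never enters the recurrence.\<close>

function bonacci :: "nat \<Rightarrow> (nat \<Rightarrow> nat) \<Rightarrow> nat \<Rightarrow> nat" where
  "bonacci m a i = (if i \<le> m then a i else (\<Sum>j = 1..m. bonacci m a (i - j)))"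
  by auto
termination
  by (relation "Wellfounded.measure (\<lambda>(m, a, i). i)") auto

declare bonacci.simps [simp del]

definition T :: "nat \<Rightarrow> nat \<Rightarrow> nat \<Rightarrow> nat" where
  "T k l = bonacci (k - 1) (\<lambda>i. if i < l then 0 else 1)"

definition S :: "nat \<Rightarrow> nat \<Rightarrow> nat" where
  "S k = bonacci (k - 1) (\<lambda>i. if i = 1 then 1 else 2 ^ (i - 2))"

definition polygon_constructible :: "nat \<Rightarrow> nat \<Rightarrow> (nat \<Rightarrow> real) \<Rightarrow> bool" where
  "polygon_constructible n k u \<longleftrightarrow>
     (\<exists>K \<subseteq> {1..n}. card K = k \<and>
        (\<exists>m\<in>K. (\<forall>j\<in>K. u j \<le> u m) \<and> u m < (\<Sum>j\<in>K - {m}. u j)))"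

end

theory Submission
  imports Defs "HOL-Combinatorics.Permutations"
begin

text \<open>
  Ties have probability zero, so by symmetry the probability is \<open>n!\<close> times the volume of the set of
  increasing vectors \<open>x\<close> from which no \<open>k\<close>-gon can be formed. For increasing vectors it suffices to test
  blocks of \<open>k\<close> consecutive lengths, so this set is the part with \<open>x\<^sub>n \<le> 1\<close> of a simplicial cone
  \<open>x\<^sub>i \<ge> L\<^sub>i(x\<^sub>1, \<dots>, x\<^bsub>i-1\<^esub>)\<close>, where \<open>L\<^sub>1 = 0\<close>, \<open>L\<^sub>i = x\<^bsub>i-1\<^esub>\<close> for \<open>1 < i < k\<close>, and
  \<open>L\<^sub>i\<close> is the sum of the \<open>k - 1\<close> preceding coordinates for \<open>i \<ge> k\<close>. Integrating out the coordinates
  from the last to the first gives the volume \<open>1 / (n! \<Prod>\<^sub>j c\<^sub>j)\<close>, where \<open>c\<^sub>j\<close> is the \<open>n\<close>-th term of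
  the solution of \<open>x\<^sub>i = L\<^sub>i\<close> (\<open>i > j\<close>) that vanishes before \<open>j\<close> and equals 1 at \<open>j\<close>; up to a shift of
  the index, these solutions are the sequences \<open>T\<^bsub>k,l\<^esub>\<close>.
\<close>

section \<open>Volume of a truncated simplicial cone\<close>

text \<open>Unlike \<open>max 0 z ^ r / fact r\<close>, this vanishes on negative \<open>z\<close> also for \<open>r = 0\<close>.\<close>

definition trunc_power :: "nat \<Rightarrow> real \<Rightarrow> real" where
  "trunc_power r z = (if 0 \<le> z then z ^ r / fact r else 0)"

lemma trunc_power_nonneg [simp]: "0 \<le> trunc_power r z"
  by (simp add: trunc_power_def)

lemma borel_measurable_trunc_power [measurable]: "trunc_power r \<in> borel_measurable borel"
  unfolding trunc_power_def by measurable

text \<open>On \<open>y \<le> c / a\<close> the integrand has the antiderivative \<open>F\<close>,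
  which vanishes at \<open>c / a\<close>; beyond that point the truncation makes it 0. So the
  half-line contributes only \<open>{d..c / a}\<close>, and nothing when
  \<open>c / a < d\<close>.\<close>

lemma nn_integral_trunc_power:
  fixes a c d :: real
  assumes "0 < a"
  shows "(\<integral>\<^sup>+y. ennreal (trunc_power r (c - a * y)) * indicator {d..} y \<partial>lborel)
           = ennreal (trunc_power (Suc r) (c - a * d) / a)"
proof (cases "0 \<le> c - a * d")
  case True
  then have le: "d \<le> c / a" using assms by (simp add: field_simps)
  define F where "F y = - ((c - a * y) ^ Suc r / (fact (Suc r) * a))" for y
  have deriv: "(F has_real_derivative (c - a * y) ^ r / fact r) (at y)" for y
  proof -
    have "(F has_real_derivative - ((of_nat (Suc r) * (c - a * y) ^ r * (0 - a)) / (fact (Suc r) * a))) (at y)"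
      unfolding F_def using assms by (auto intro!: derivative_eq_intros simp del: power_Suc)
    moreover have "- ((of_nat (Suc r) * (c - a * y) ^ r * (0 - a)) / (fact (Suc r) * a))
        = (c - a * y) ^ r / fact r"
      using assms by (simp add: fact_Suc del: of_nat_Suc)
    ultimately show ?thesis by simp
  qed
  have "(\<integral>\<^sup>+y. ennreal (trunc_power r (c - a * y)) * indicator {d..} y \<partial>lborel)
     = (\<integral>\<^sup>+y. ennreal ((c - a * y) ^ r / fact r) * indicator {d..c / a} y \<partial>lborel)"
    using assms
    by (intro nn_integral_cong) (auto simp: trunc_power_def indicator_def field_simps)
  also have "\<dots> = F (c / a) - F d"
  proof (rule nn_integral_FTC_Icc)
    show "(\<lambda>y. (c - a * y) ^ r / fact r) \<in> borel_measurable borel" by measurable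
    show "d \<le> c / a" by (fact le)
    show "\<And>y. y \<in> {d..c / a} \<Longrightarrow> (F has_real_derivative (c - a * y) ^ r / fact r) (at y)"
      by (rule deriv)
    show "\<And>y. y \<in> {d..c / a} \<Longrightarrow> 0 \<le> (c - a * y) ^ r / fact r"
      using assms by (auto simp: field_simps)
  qed
  also have "F (c / a) - F d = trunc_power (Suc r) (c - a * d) / a"
    using True assms by (simp add: F_def trunc_power_def)
  finally show ?thesis .
next
  case False
  have zero: "trunc_power r (c - a * y) = 0" if "d \<le> y" for y
  proof -
    have "a * d \<le> a * y" using that assms by simp
    then show ?thesis using False by (simp add: trunc_power_def)
  qed
  have "(\<integral>\<^sup>+y. ennreal (trunc_power r (c - a * y)) * indicator {d..} y \<partial>lborel) = (\<integral>\<^sup>+y. 0 \<partial>(lborel :: real measure))"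
    by (intro nn_integral_cong) (auto simp: indicator_def zero)
  then show ?thesis using False by (simp add: trunc_power_def)
qed

lemma measurable_cone_integrand:
  fixes w :: "nat \<Rightarrow> nat \<Rightarrow> real" and a :: "nat \<Rightarrow> real"
  shows "(\<lambda>x. ennreal (trunc_power r (c - (\<Sum>i = 1..n. a i * x i))) *
      indicator {x. \<forall>i\<in>{1..n}. (\<Sum>l = 1..<i. w i l * x l) \<le> x i} x)
    \<in> borel_measurable (PiM {1..n} (\<lambda>_. lborel :: real measure))"
proof -
  let ?P = "PiM {1..n} (\<lambda>_. lborel :: real measure)"
  have comp: "(\<lambda>x. x i) \<in> borel_measurable ?P" if "i \<in> {1..n}" for i
    using measurable_component_singleton[OF that, of "\<lambda>_. lborel :: real measure"] by simp
  have sums: "(\<lambda>x. \<Sum>l\<in>A. v l * x l) \<in> borel_measurable ?P"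
    if "A \<subseteq> {1..n}" for A and v :: "nat \<Rightarrow> real"
    using that by (intro borel_measurable_sum borel_measurable_times comp) auto
  have "Measurable.pred ?P (\<lambda>x. \<forall>i\<in>{1..n}. (\<Sum>l = 1..<i. w i l * x l) \<le> x i)"
  proof (rule pred_intros_finite)
    fix i assume i: "i \<in> {1..n}"
    then show "Measurable.pred ?P (\<lambda>x. (\<Sum>l = 1..<i. w i l * x l) \<le> x i)"
      unfolding pred_def by (intro borel_measurable_le sums comp) auto
  qed simp
  then have "(indicator {x. \<forall>i\<in>{1..n}. (\<Sum>l = 1..<i. w i l * x l) \<le> x i} :: _ \<Rightarrow> ennreal)
      \<in> borel_measurable ?P"
    by (subst borel_measurable_indicator_iff) (simp add: pred_def Int_def conj_commute)
  moreover have "(\<lambda>x. \<Sum>i = 1..n. a i * x i) \<in> borel_measurable ?P"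
    by (rule sums) simp
  then have "(\<lambda>x. ennreal (trunc_power r (c - (\<Sum>i = 1..n. a i * x i)))) \<in> borel_measurable ?P"
    by (intro measurable_compose[OF _ measurable_ennreal] measurable_compose[OF _ borel_measurable_trunc_power]
        borel_measurable_diff) auto
  ultimately show ?thesis by (intro borel_measurable_times_ennreal)
qed

text \<open>Integrating out \<open>x\<^sub>n\<close> replaces \<open>r\<close> by \<open>r + 1\<close> and substitutes the lower bound for \<open>x\<^sub>n\<close> in the linear
  form; the values of the form at the vectors \<open>e j\<close> are unchanged by this substitution.\<close>

lemma nn_integral_cone:
  fixes w e :: "nat \<Rightarrow> nat \<Rightarrow> real" and a :: "nat \<Rightarrow> real"
  assumes e_diag: "\<And>j. e j j = 1"
    and e_rec: "\<And>j i. 1 \<le> j \<Longrightarrow> j < i \<Longrightarrow> e j i = (\<Sum>l = j..<i. w i l * e j l)"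
    and "\<And>j. j \<in> {1..n} \<Longrightarrow> 0 < (\<Sum>i = j..n. a i * e j i)"
  shows "(\<integral>\<^sup>+x. ennreal (trunc_power r (c - (\<Sum>i = 1..n. a i * x i))) *
             indicator {x. \<forall>i\<in>{1..n}. (\<Sum>l = 1..<i. w i l * x l) \<le> x i} x
           \<partial>PiM {1..n} (\<lambda>_. lborel))
         = ennreal (trunc_power (r + n) c / (\<Prod>j = 1..n. \<Sum>i = j..n. a i * e j i))"
  using assms(3)
proof (induction n arbitrary: a r)
  case 0
  interpret product_sigma_finite "\<lambda>_::nat. lborel :: real measure" by standard
  show ?case by (simp add: PiM_empty nn_integral_count_space_finite)
next
  case (Suc n)
  interpret product_sigma_finite "\<lambda>_::nat. lborel :: real measure" by standard
  \<comment> \<open>These are the coefficients of the form once its last variable is replaced by the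
    lower bound \<open>\<Sum>l = 1..n. w (Suc n) l * x l\<close>.\<close>
  define a' where "a' i = a i + a (Suc n) * w (Suc n) i" for i
  have ins: "{1..Suc n} = insert (Suc n) {1..n}" by auto
  have a_pos: "0 < a (Suc n)"
    using Suc.prems[of "Suc n"] e_diag by simp
  have coeff: "(\<Sum>i = j..Suc n. a i * e j i) = (\<Sum>i = j..n. a' i * e j i)" if "j \<in> {1..n}" for j
  proof -
    have "(\<Sum>i = j..Suc n. a i * e j i) = (\<Sum>i = j..n. a i * e j i) + a (Suc n) * e j (Suc n)"
      using that by simp
    also have "e j (Suc n) = (\<Sum>l = j..n. w (Suc n) l * e j l)"
      using that by (subst e_rec) (auto simp: atLeastLessThanSuc_atLeastAtMost)
    finally show ?thesis
      by (simp add: a'_def sum.distrib sum_distrib_left algebra_simps)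
  qed
  let ?f = "\<lambda>x. ennreal (trunc_power r (c - (\<Sum>i = 1..Suc n. a i * x i))) *
      indicator {x. \<forall>i\<in>{1..Suc n}. (\<Sum>l = 1..<i. w i l * x l) \<le> x i} x"
  have meas: "?f \<in> borel_measurable (PiM (insert (Suc n) {1..n}) (\<lambda>_. lborel))"
    unfolding ins[symmetric] by (rule measurable_cone_integrand)
  let ?g = "\<lambda>x. ennreal (trunc_power (Suc r) (c - (\<Sum>i = 1..n. a' i * x i))) *
        indicator {x. \<forall>i\<in>{1..n}. (\<Sum>l = 1..<i. w i l * x l) \<le> x i} x"
  \<comment> \<open>With \<open>x\<close> fixed, the constraints for \<open>i \<le> n\<close> do not
    involve \<open>y\<close> and factor out as \<open>?I\<close>; the constraint for
    \<open>Suc n\<close> restricts \<open>y\<close> to a half-line, leaving a one-dimensional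
    integral.\<close>
  have inner: "(\<integral>\<^sup>+y. ?f (x(Suc n := y)) \<partial>lborel) =
      ennreal (1 / a (Suc n)) * ?g x" for x
  proof -
    let ?I = "indicator {x. \<forall>i\<in>{1..n}. (\<Sum>l = 1..<i. w i l * x l) \<le> x i} x :: ennreal"
    let ?d = "\<Sum>l = 1..n. w (Suc n) l * x l"
    let ?c = "c - (\<Sum>i = 1..n. a i * x i)"
    have "?f (x(Suc n := y)) = ennreal (trunc_power r (?c - a (Suc n) * y)) * indicator {?d..} y * ?I" for y
    proof -
      have 1: "(\<Sum>i = 1..Suc n. a i * (x(Suc n := y)) i) = (\<Sum>i = 1..n. a i * x i) + a (Suc n) * y"
        by (simp add: sum.nat_ivl_Suc')
      have 2: "(\<Sum>l = 1..<i. w i l * (x(Suc n := y)) l) = (\<Sum>l = 1..<i. w i l * x l)"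
        if "i \<in> {1..Suc n}" for i
        using that by (intro sum.cong) auto
      have 3: "(\<forall>i\<in>{1..Suc n}. (\<Sum>l = 1..<i. w i l * (x(Suc n := y)) l) \<le> (x(Suc n := y)) i)
           \<longleftrightarrow> ?d \<le> y \<and> (\<forall>i\<in>{1..n}. (\<Sum>l = 1..<i. w i l * x l) \<le> x i)"
      proof -
        have "(\<forall>i\<in>{1..Suc n}. (\<Sum>l = 1..<i. w i l * (x(Suc n := y)) l) \<le> (x(Suc n := y)) i)
           \<longleftrightarrow> (\<forall>i\<in>{1..Suc n}. (\<Sum>l = 1..<i. w i l * x l) \<le> (x(Suc n := y)) i)"
          by (intro ball_cong) (simp_all only: 2)
        also have "\<dots> \<longleftrightarrow> (\<Sum>l = 1..<Suc n. w (Suc n) l * x l) \<le> y \<and>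
            (\<forall>i\<in>{1..n}. (\<Sum>l = 1..<i. w i l * x l) \<le> x i)"
          unfolding ins by (auto simp del: sum.op_ivl_Suc)
        finally show ?thesis unfolding atLeastLessThanSuc_atLeastAtMost .
      qed
      show ?thesis
        unfolding 1 indicator_def mem_Collect_eq 3 by (auto simp: algebra_simps)
    qed
    then have "(\<integral>\<^sup>+y. ?f (x(Suc n := y)) \<partial>lborel) =
       (\<integral>\<^sup>+y. ennreal (trunc_power r (?c - a (Suc n) * y)) * indicator {?d..} y \<partial>lborel) * ?I"
      by (subst nn_integral_multc[symmetric]) (auto intro!: nn_integral_cong)
    also have "\<dots> = ennreal (trunc_power (Suc r) (?c - a (Suc n) * ?d) / a (Suc n)) * ?I"
      by (subst nn_integral_trunc_power[OF a_pos]) simp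
    also have "?c - a (Suc n) * ?d = c - (\<Sum>i = 1..n. a' i * x i)"
      by (simp add: a'_def sum.distrib sum_distrib_left algebra_simps)
    also have "ennreal (trunc_power (Suc r) (c - (\<Sum>i = 1..n. a' i * x i)) / a (Suc n)) =
        ennreal (1 / a (Suc n)) * ennreal (trunc_power (Suc r) (c - (\<Sum>i = 1..n. a' i * x i)))"
      using a_pos by (subst ennreal_mult[symmetric]) auto
    finally show ?thesis by (simp only: mult.assoc)
  qed
  have "integral\<^sup>N (PiM {1..Suc n} (\<lambda>_. lborel)) ?f
      = (\<integral>\<^sup>+x. ennreal (1 / a (Suc n)) * ?g x \<partial>PiM {1..n} (\<lambda>_. lborel))"
  proof -
    have "integral\<^sup>N (PiM {1..Suc n} (\<lambda>_. lborel)) ?f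
        = (\<integral>\<^sup>+x. (\<integral>\<^sup>+y. ?f (x(Suc n := y)) \<partial>lborel) \<partial>PiM {1..n} (\<lambda>_. lborel))"
      unfolding ins by (rule product_nn_integral_insert[OF _ _ meas[unfolded ins]]) auto
    then show ?thesis by (simp only: inner)
  qed
  also have "\<dots> = ennreal (1 / a (Suc n)) * integral\<^sup>N (PiM {1..n} (\<lambda>_. lborel)) ?g"
    by (intro nn_integral_cmult measurable_cone_integrand)
  also have "integral\<^sup>N (PiM {1..n} (\<lambda>_. lborel)) ?g
      = ennreal (trunc_power (Suc r + n) c / (\<Prod>j = 1..n. \<Sum>i = j..n. a' i * e j i))"
    using Suc.prems coeff by (intro Suc.IH) (metis atLeastAtMost_iff le_Suc_eq)
  also have "ennreal (1 / a (Suc n)) * \<dots> = ennreal (trunc_power (r + Suc n) c /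
      ((\<Prod>j = 1..n. \<Sum>i = j..n. a' i * e j i) * a (Suc n)))"
    using a_pos by (subst ennreal_mult'[symmetric]) (auto simp: mult_ac)
  \<comment> \<open>The divisor \<open>a (Suc n)\<close> produced by the inner integral is the
    factor for \<open>j = Suc n\<close>, because \<open>e j j = 1\<close>.\<close>
  also have "(\<Prod>j = 1..n. \<Sum>i = j..n. a' i * e j i) * a (Suc n) = (\<Prod>j = 1..Suc n. \<Sum>i = j..Suc n. a i * e j i)"
    using coeff e_diag by (simp add: prod.nat_ivl_Suc' del: sum.cl_ivl_Suc)
  finally show ?case .
qed

section \<open>Bonacci sequences\<close>

lemma bonacci_init: "i \<le> m \<Longrightarrow> bonacci m a i = a i"
  by (simp add: bonacci.simps)

lemma bonacci_rec: "m < i \<Longrightarrow> bonacci m a i = (\<Sum>l = i - m..<i. bonacci m a l)"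
proof -
  assume "m < i"
  then have "bonacci m a i = (\<Sum>j = 1..m. bonacci m a (i - j))"
    by (subst bonacci.simps) simp
  also have "\<dots> = (\<Sum>l = i - m..<i. bonacci m a l)"
    using \<open>m < i\<close> by (intro sum.reindex_bij_witness[of _ "\<lambda>l. i - l" "\<lambda>j. i - j"]) auto
  finally show ?thesis .
qed

text \<open>A solution of the recurrence is determined by its initial terms. The dummy index 0 is
  excluded from the claim; for \<open>m < i\<close> the window starts at
  \<open>i - m \<ge> 1\<close> and never reaches it.\<close>

lemma bonacci_eqI:
  assumes init: "\<And>i. 1 \<le> i \<Longrightarrow> i \<le> m \<Longrightarrow> f i = a i"
    and rec: "\<And>i. m < i \<Longrightarrow> f i = (\<Sum>l = i - m..<i. f l)"
    and "1 \<le> i"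
  shows "f i = bonacci m a i"
  using \<open>1 \<le> i\<close>
proof (induction i rule: less_induct)
  case (less i)
  show ?case
  proof (cases "i \<le> m")
    case True
    then show ?thesis using init less.prems by (simp add: bonacci_init)
  next
    case False
    then show ?thesis using less.IH by (auto simp: rec bonacci_rec intro!: sum.cong)
  qed
qed

lemma T_init: "i \<le> k - 1 \<Longrightarrow> T k l i = (if i < l then 0 else 1)"
  by (simp add: T_def bonacci_init)

lemma T_rec: "k - 1 < i \<Longrightarrow> T k l i = (\<Sum>j = i - (k - 1)..<i. T k l j)"
  by (simp add: T_def bonacci_rec)

text \<open>Past the initial terms the window contains the previous index, as
  \<open>k - 1 \<ge> 1\<close>, so each term is at least its predecessor. This supplies the positive
  coefficients required for integrating over the cone.\<close>

lemma T_pos: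
  assumes "2 \<le> k" "l \<le> k - 1" "l \<le> i"
  shows "0 < T k l i"
  using \<open>l \<le> i\<close>
proof (induction i rule: less_induct)
  case (less i)
  show ?case
  proof (cases "i \<le> k - 1")
    case True
    then show ?thesis using less.prems by (simp add: T_init)
  next
    case False
    then have "0 < T k l (i - 1)" using less assms by auto
    also have "T k l (i - 1) \<le> (\<Sum>j = i - (k - 1)..<i. T k l j)"
      using False assms by (intro member_le_sum) auto
    finally show ?thesis using False by (simp add: T_rec)
  qed
qed

text \<open>In this range the index that leaves the window carries the value 0, so each new term is
  the preceding term plus the whole sum that formed it, that is, twice that term.\<close>

lemma T_last_doubling:
  assumes "2 \<le> k" "1 \<le> i" "i \<le> k - 1"
  shows "T k (k - 1) (k - 1 + i) = 2 ^ (i - 1)"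
  using assms(2,3)
proof (induction i rule: nat_induct_at_least)
  case base
  have "T k (k - 1) (k - 1 + 1) = (\<Sum>j = 1..<Suc (k - 1). T k (k - 1) j)"
    by (subst T_rec) auto
  also have "\<dots> = (\<Sum>j\<in>{k - 1}. T k (k - 1) j)"
    using assms(1) by (intro sum.mono_neutral_right) (auto simp: T_init split: if_splits)
  finally show ?case by (simp add: T_init)
next
  case (Suc i)
  let ?t = "T k (k - 1)" and ?m = "k - 1"
  have "?t (?m + Suc i) = (\<Sum>j = Suc i..<Suc (?m + i). ?t j)"
    by (subst T_rec) auto
  also have "\<dots> = (\<Sum>j = Suc i..<?m + i. ?t j) + ?t (?m + i)"
    using Suc.prems by (intro sum.atLeastLessThan_Suc) auto
  also have "(\<Sum>j = Suc i..<?m + i. ?t j) = (\<Sum>j = i..<?m + i. ?t j)"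
    using Suc.prems by (subst (2) sum.atLeast_Suc_lessThan) (auto simp: T_init)
  also have "\<dots> = ?t (?m + i)"
    using Suc.hyps by (subst (2) T_rec) auto
  finally show ?case
    using Suc by (cases i) auto
qed

text \<open>Dropping the \<open>k - 2\<close> leading zeros of \<open>T k (k - 1)\<close> leaves 1,
  1, 2, 4, ..., which are the initial terms of \<open>S k\<close>; the recurrence is invariant under
  shifts.\<close>

lemma S_eq_T_last:
  assumes "3 \<le> k" "1 \<le> i"
  shows "S k i = T k (k - 1) (k - 2 + i)"
  unfolding S_def
proof (rule bonacci_eqI[symmetric, OF _ _ \<open>1 \<le> i\<close>])
  fix i assume i: "1 \<le> i" "i \<le> k - 1"
  show "T k (k - 1) (k - 2 + i) = (if i = 1 then 1 else 2 ^ (i - 2))"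
  proof (cases "i = 1")
    case True
    then have "k - 2 + i = k - 1" using assms by simp
    then show ?thesis using True by (simp add: T_init)
  next
    case False
    then have "k - 2 + i = k - 1 + (i - 1)" "i - 1 - 1 = i - 2" using i assms by auto
    then show ?thesis using False i assms T_last_doubling[of k "i - 1"] by simp
  qed
next
  fix i assume "k - 1 < i"
  then have "T k (k - 1) (k - 2 + i) = (\<Sum>j = (i - (k - 1)) + (k - 2)..<i + (k - 2). T k (k - 1) j)"
    using assms by (subst T_rec) (auto simp: algebra_simps)
  also have "\<dots> = (\<Sum>l = i - (k - 1)..<i. T k (k - 1) (k - 2 + l))"
    by (subst sum.shift_bounds_nat_ivl) (simp add: add.commute)
  finally show "T k (k - 1) (k - 2 + i) = \<dots>" .
qed

text \<open>The first term of \<open>T k (k - 1)\<close> after its initial segment is again 1. Read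
  from index 2 on, this sequence therefore begins with \<open>k - 3\<close> zeros and two ones, as
  \<open>T k (k - 2)\<close> does.\<close>

lemma T_penultimate:
  assumes "3 \<le> k" "1 \<le> i"
  shows "T k (k - 2) i = T k (k - 1) (Suc i)"
  unfolding T_def[of k "k - 2"]
proof (rule bonacci_eqI[symmetric, OF _ _ \<open>1 \<le> i\<close>])
  fix i assume i: "1 \<le> i" "i \<le> k - 1"
  show "T k (k - 1) (Suc i) = (if i < k - 2 then 0 else 1)"
  proof (cases "i = k - 1")
    case True
    then show ?thesis using assms T_last_doubling[of k 1] by auto
  qed (use i in \<open>auto simp: T_init\<close>)
next
  fix i assume "k - 1 < i"
  then show "T k (k - 1) (Suc i) = (\<Sum>l = i - (k - 1)..<i. T k (k - 1) (Suc l))"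
    by (subst T_rec) (auto simp: sum.shift_bounds_Suc_ivl[symmetric] Suc_diff_le simp del: sum.op_ivl_Suc)
qed

text \<open>All factors except those with \<open>l \<le> k - 3\<close> are values of
  \<open>S k\<close>: the second product gives the indices \<open>1\<close> to
  \<open>n - k + 1\<close> in reverse order, and \<open>l = k - 1\<close>, \<open>l = k - 2\<close>
  give \<open>n - k + 2\<close> and \<open>n - k + 3\<close>.\<close>

lemma prod_T_eq_prod_S:
  assumes "3 \<le> k" "k \<le> n"
  shows "(\<Prod>l = 1..k - 1. T k l n) * (\<Prod>i = 1..n - k + 1. T k (k - 1) (n - i))
       = (\<Prod>l = 1..k - 3. T k l n) * (\<Prod>i = 1..n - k + 3. S k i)"
proof -
  have "{1..k - 1} = insert (k - 1) (insert (k - 2) {1..k - 3})"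
    "k - 1 \<notin> insert (k - 2) {1..k - 3}" "k - 2 \<notin> {1..k - 3}" using assms by auto
  then have 1: "(\<Prod>l = 1..k - 1. T k l n) = T k (k - 1) n * T k (k - 2) n * (\<Prod>l = 1..k - 3. T k l n)"
    by (simp del: One_nat_def)
  have "{1..n - k + 3} = insert (n - k + 3) (insert (n - k + 2) {1..n - k + 1})" using assms by auto
  then have 2: "(\<Prod>i = 1..n - k + 3. S k i)
      = S k (n - k + 3) * S k (n - k + 2) * (\<Prod>i = 1..n - k + 1. S k i)"
    by simp
  have 3: "(\<Prod>i = 1..n - k + 1. S k i) = (\<Prod>i = 1..n - k + 1. T k (k - 1) (n - i))"
    using assms
    by (intro prod.reindex_bij_witness[of _ "\<lambda>i. n - k + 2 - i" "\<lambda>i. n - k + 2 - i"])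
       (auto simp: S_eq_T_last intro!: arg_cong[of _ _ "T k _"])
  have 4: "S k (n - k + 3) = T k (k - 2) n" "S k (n - k + 2) = T k (k - 1) n"
    using assms by (auto simp: S_eq_T_last T_penultimate intro!: arg_cong[of _ _ "T k _"])
  show ?thesis unfolding 1 2 3 4 by simp
qed

section \<open>Increasing lengths\<close>

text \<open>Exchange argument: \<open>A - ?W\<close> and \<open>?W - A\<close> have the same size,
  and the value \<open>x (i - m)\<close> at the lower end of the window separates the entries of the
  first from those of the second.\<close>

lemma sum_le_sum_top:
  fixes x :: "nat \<Rightarrow> real"
  assumes mono: "\<And>j l. 1 \<le> j \<Longrightarrow> j \<le> l \<Longrightarrow> l < i \<Longrightarrow> x j \<le> x l"
    and A: "A \<subseteq> {1..<i}" "card A = m"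
  shows "sum x A \<le> (\<Sum>l = i - m..<i. x l)"
proof (cases "A = {}")
  case True
  then show ?thesis using A by simp
next
  case False
  let ?W = "{i - m..<i}"
  have fin: "finite A" using A finite_subset by blast
  have "m \<le> i - 1"
    using A card_mono[of "{1..<i}" A] by simp
  moreover have "0 < m" using A False fin by (auto simp: card_gt_0_iff)
  ultimately have cardW: "card ?W = m" by simp
  have "card (A - ?W) = card (?W - A)"
    using fin cardW A card_Diff_subset_Int[of A ?W] card_Diff_subset_Int[of ?W A]
    by (simp add: Int_commute)
  have "sum x (A - ?W) \<le> of_nat (card (A - ?W)) * x (i - m)"
    using A \<open>m \<le> i - 1\<close> \<open>0 < m\<close> by (intro sum_bounded_above mono) (auto simp: subset_eq)
  also have "\<dots> = of_nat (card (?W - A)) * x (i - m)"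
    by (simp add: \<open>card (A - ?W) = card (?W - A)\<close>)
  also have "\<dots> \<le> sum x (?W - A)"
    using \<open>m \<le> i - 1\<close> by (intro sum_bounded_below mono) auto
  finally have "sum x (A - ?W) + sum x (A \<inter> ?W) \<le> sum x (?W - A) + sum x (A \<inter> ?W)"
    by simp
  then show ?thesis
    using sum.Int_Diff[OF fin, of x ?W] sum.Int_Diff[of ?W x A] by (simp add: Int_commute add.commute)
qed

text \<open>Once the largest index \<open>i\<close> is fixed, the \<open>k - 1\<close> lengths just
  below it give the largest possible sum of the other sides, so blocks of consecutive indices decide
  the matter.\<close>

lemma polygon_constructible_sorted_iff:
  fixes x :: "nat \<Rightarrow> real"
  assumes mono: "\<And>i j. 1 \<le> i \<Longrightarrow> i \<le> j \<Longrightarrow> j \<le> n \<Longrightarrow> x i \<le> x j" and "1 \<le> k"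
  shows "polygon_constructible n k x \<longleftrightarrow> (\<exists>i\<in>{k..n}. x i < (\<Sum>l = i - (k - 1)..<i. x l))"
proof
  assume "polygon_constructible n k x"
  then obtain K m where K: "K \<subseteq> {1..n}" "card K = k" "m \<in> K"
    and max: "\<forall>j\<in>K. x j \<le> x m" and less: "x m < sum x (K - {m})"
    unfolding polygon_constructible_def by blast
  define i where "i = Max K"
  have fin: "finite K" using K finite_subset by blast
  have "K \<noteq> {}" using K by blast
  then have i: "i \<in> K" "\<And>j. j \<in> K \<Longrightarrow> j \<le> i"
    using fin by (auto simp: i_def)
  \<comment> \<open>With ties the longest side \<open>m\<close> need not have the largest index;
    since the two lengths agree, \<open>i\<close> can take its place.\<close>
  have "x i = x m"
    using max i(1) i(2)[OF K(3)] K mono[of m i] by (intro antisym) (auto simp: subset_eq)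
  then have less': "x i < sum x (K - {i})"
    using less fin i K by (simp add: sum_diff1)
  have "K \<subseteq> {1..i}" using K i by auto
  then have "k \<le> i" using K card_mono[of "{1..i}" K] by simp
  have "i \<le> n" using K(1) i(1) by auto
  have "sum x (K - {i}) \<le> (\<Sum>l = i - (k - 1)..<i. x l)"
  proof (rule sum_le_sum_top)
    show "K - {i} \<subseteq> {1..<i}"
    proof
      fix j assume "j \<in> K - {i}"
      then show "j \<in> {1..<i}" using i(2)[of j] K(1) by auto
    qed
    show "card (K - {i}) = k - 1" using K i by simp
    show "\<And>j l. 1 \<le> j \<Longrightarrow> j \<le> l \<Longrightarrow> l < i \<Longrightarrow> x j \<le> x l"
      using \<open>i \<le> n\<close> by (intro mono) auto
  qed
  with less' have "x i < (\<Sum>l = i - (k - 1)..<i. x l)" by simp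
  moreover have "i \<in> {k..n}" using \<open>k \<le> i\<close> \<open>i \<le> n\<close> by simp
  ultimately show "\<exists>i\<in>{k..n}. x i < (\<Sum>l = i - (k - 1)..<i. x l)" by blast
next
  assume "\<exists>i\<in>{k..n}. x i < (\<Sum>l = i - (k - 1)..<i. x l)"
  then obtain i where i: "k \<le> i" "i \<le> n" "x i < (\<Sum>l = i - (k - 1)..<i. x l)" by auto
  let ?K = "{i - (k - 1)..i}"
  have "?K - {i} = {i - (k - 1)..<i}" by auto
  then have "x i < sum x (?K - {i})" using i by simp
  moreover have "\<forall>j\<in>?K. x j \<le> x i" using i \<open>1 \<le> k\<close> by (intro ballI mono) auto
  moreover have "?K \<subseteq> {1..n}" "card ?K = k" "i \<in> ?K" using i \<open>1 \<le> k\<close> by auto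
  ultimately show "polygon_constructible n k x"
    unfolding polygon_constructible_def by blast
qed

section \<open>Increasing polygon-free vectors as a simplicial cone\<close>

text \<open>Coefficients of the linear forms \<open>L\<^sub>i\<close>; only indices \<open>l < i\<close> are meaningful.\<close>

definition gap_weight :: "nat \<Rightarrow> nat \<Rightarrow> nat \<Rightarrow> real" where
  "gap_weight k i l = (if if i \<le> k - 1 then Suc l = i else i - (k - 1) \<le> l then 1 else 0)"

lemma sum_gap_weight_init:
  assumes "1 \<le> j" "j < i" "i \<le> k - 1"
  shows "(\<Sum>l = j..<i. gap_weight k i l * x l) = x (i - 1)"
proof -
  have "(\<Sum>l = j..<i. gap_weight k i l * x l) = (\<Sum>l\<in>{i - 1}. gap_weight k i l * x l)"
    using assms by (intro sum.mono_neutral_right) (auto simp: gap_weight_def)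
  then show ?thesis using assms by (simp add: gap_weight_def)
qed

text \<open>The window may reach below \<open>j\<close>, where \<open>x\<close> is required to
  vanish. For \<open>j = 1\<close> this requirement is vacuous, which covers arbitrary vectors;
  larger \<open>j\<close> serve the sequences that start at \<open>j\<close>.\<close>

lemma sum_gap_weight_step:
  assumes "k - 1 < i" "\<And>l. l < j \<Longrightarrow> i - (k - 1) \<le> l \<Longrightarrow> x l = 0"
  shows "(\<Sum>l = j..<i. gap_weight k i l * x l) = (\<Sum>l = i - (k - 1)..<i. x l)"
proof -
  have "(\<Sum>l = j..<i. gap_weight k i l * x l) = (\<Sum>l\<in>{j..<i} \<inter> {i - (k - 1)..<i}. gap_weight k i l * x l)"
    using assms by (intro sum.mono_neutral_right) (auto simp: gap_weight_def)
  also have "\<dots> = (\<Sum>l\<in>{j..<i} \<inter> {i - (k - 1)..<i}. x l)"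
    using assms by (intro sum.cong) (auto simp: gap_weight_def)
  also have "\<dots> = (\<Sum>l = i - (k - 1)..<i. x l)"
    using assms by (intro sum.mono_neutral_left) auto
  finally show ?thesis .
qed

text \<open>For \<open>i < k\<close> the cone inequalities are \<open>0 \<le> x 1\<close> and the
  monotonicity steps themselves. For \<open>i \<ge> k\<close> monotonicity follows: the block sum
  has nonnegative terms, one of which is \<open>x (i - 1)\<close>.\<close>

lemma gap_cone_iff:
  fixes x :: "nat \<Rightarrow> real"
  assumes "3 \<le> k"
  shows "(\<forall>i\<in>{1..n}. (\<Sum>l = 1..<i. gap_weight k i l * x l) \<le> x i) \<longleftrightarrow>
    (\<forall>i\<in>{1..n}. 0 \<le> x i) \<and> (\<forall>i j. 1 \<le> i \<and> i \<le> j \<and> j \<le> n \<longrightarrow> x i \<le> x j) \<and>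
    (\<forall>i\<in>{k..n}. (\<Sum>l = i - (k - 1)..<i. x l) \<le> x i)" (is "?L \<longleftrightarrow> ?R")
proof
  assume L: ?L
  have step: "(\<Sum>l = i - (k - 1)..<i. x l) \<le> x i" if "i \<in> {k..n}" for i
  proof -
    have "k - 1 < i" using that assms by auto
    then show ?thesis using bspec[OF L, of i] that assms sum_gap_weight_step[of k i 1 x] by simp
  qed
  have "0 \<le> x i \<and> (\<forall>j. 1 \<le> j \<and> j \<le> i \<longrightarrow> x j \<le> x i)" if "1 \<le> i" "i \<le> n" for i
    using that
  proof (induction i rule: less_induct)
    case (less i)
    show ?case
    proof (cases "i = 1")
      case True
      then show ?thesis using bspec[OF L, of 1] less.prems by auto
    next
      case False
      have IH: "0 \<le> x (i - 1) \<and> (\<forall>j. 1 \<le> j \<and> j \<le> i - 1 \<longrightarrow> x j \<le> x (i - 1))"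
        using False less by (intro less.IH) auto
      have "x (i - 1) \<le> x i"
      proof (cases "i \<le> k - 1")
        case True
        then show ?thesis using bspec[OF L, of i] sum_gap_weight_init[of 1 i k x] False less.prems by simp
      next
        case *: False
        have "0 \<le> x l" if "l \<in> {i - (k - 1)..<i}" for l
          using that * less by (intro less.IH[THEN conjunct1]) auto
        then have "x (i - 1) \<le> (\<Sum>l = i - (k - 1)..<i. x l)"
          using * assms by (intro member_le_sum) auto
        also have "\<dots> \<le> x i" using * assms less.prems by (intro step) auto
        finally show ?thesis .
      qed
      moreover have "j = i \<or> j \<le> i - 1" if "j \<le> i" for j using that by linarith
      ultimately show ?thesis using IH by (metis order_refl order_trans)
    qed
  qed
  then have "0 \<le> x i" "1 \<le> j \<Longrightarrow> j \<le> i \<Longrightarrow> x j \<le> x i" if "i \<in> {1..n}" for i j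
    using that by simp_all
  then show ?R using step by simp
next
  assume R: ?R
  show ?L
  proof
    fix i assume i: "i \<in> {1..n}"
    consider "i = 1" | "1 < i" "i \<le> k - 1" | "k \<le> i" using i by fastforce
    then show "(\<Sum>l = 1..<i. gap_weight k i l * x l) \<le> x i"
    proof cases
      case 1 then show ?thesis using R i by auto
    next
      case 2 then show ?thesis using R i sum_gap_weight_init[of 1 i k x] by auto
    next
      case 3
      then have "k - 1 < i" using assms by auto
      then show ?thesis using 3 R i assms sum_gap_weight_step[of k i 1 x] by auto
    qed
  qed
qed

text \<open>For increasing vectors the upper bounds all reduce to the one on \<open>x n\<close>. The
  event thus becomes a cone truncated by a single linear form, the shape that
  \<open>nn_integral_cone\<close> handles.\<close>

lemma sorted_not_polygon_iff:
  fixes x :: "nat \<Rightarrow> real"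
  assumes "3 \<le> k" "1 \<le> n"
  shows "(\<forall>i\<in>{1..n}. x i \<in> {0..1}) \<and> (\<forall>i j. 1 \<le> i \<and> i \<le> j \<and> j \<le> n \<longrightarrow> x i \<le> x j) \<and>
      \<not> polygon_constructible n k x \<longleftrightarrow>
    (\<forall>i\<in>{1..n}. (\<Sum>l = 1..<i. gap_weight k i l * x l) \<le> x i) \<and> x n \<le> 1"
proof (cases "\<forall>i j. 1 \<le> i \<and> i \<le> j \<and> j \<le> n \<longrightarrow> x i \<le> x j")
  case True
  then have "polygon_constructible n k x \<longleftrightarrow> (\<exists>i\<in>{k..n}. x i < (\<Sum>l = i - (k - 1)..<i. x l))"
    using assms by (intro polygon_constructible_sorted_iff) auto
  moreover have "(\<forall>i\<in>{1..n}. x i \<le> 1) \<longleftrightarrow> x n \<le> 1"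
  proof
    assume "x n \<le> 1"
    then show "\<forall>i\<in>{1..n}. x i \<le> 1" using True by (fastforce intro: order_trans)
  qed (use assms in simp)
  moreover have "(\<forall>i\<in>{1..n}. x i \<in> {0..1}) \<longleftrightarrow> (\<forall>i\<in>{1..n}. 0 \<le> x i) \<and> (\<forall>i\<in>{1..n}. x i \<le> 1)"
    unfolding atLeastAtMost_iff[of "x _"] by blast
  moreover have "\<not> (\<exists>i\<in>{k..n}. x i < (\<Sum>l = i - (k - 1)..<i. x l)) \<longleftrightarrow>
      (\<forall>i\<in>{k..n}. (\<Sum>l = i - (k - 1)..<i. x l) \<le> x i)"
    by (meson not_less)
  ultimately show ?thesis
    using True unfolding gap_cone_iff[OF assms(1)] by argo
next
  case False
  then show ?thesis unfolding gap_cone_iff[OF assms(1)] by blast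
qed

section \<open>Fundamental solutions of the cone equations\<close>

text \<open>The sequence started at \<open>j\<close>: the truncated difference \<open>j - (k - 1)\<close> makes it \<open>T k j\<close> for
  \<open>j \<le> k - 1\<close> and a shift of \<open>T k (k - 1)\<close> for larger \<open>j\<close>.\<close>

definition fundamental :: "nat \<Rightarrow> nat \<Rightarrow> nat \<Rightarrow> real" where
  "fundamental k j i = real (T k (min j (k - 1)) (i - (j - (k - 1))))"

lemma fundamental_diag: "fundamental k j j = 1"
  by (cases "j \<le> k - 1") (auto simp: fundamental_def T_init)

text \<open>For \<open>j > k - 1\<close> the truncated shift may send \<open>l\<close> to index 0;
  the dummy value of \<open>T k (k - 1)\<close> there is 0, as wanted.\<close>

lemma fundamental_before:
  assumes "2 \<le> k" "l < j"
  shows "fundamental k j l = 0"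
  using assms by (cases "j \<le> k - 1") (auto simp: fundamental_def T_init)

text \<open>Up to \<open>k - 1\<close> both sides equal 1. Beyond that it is the shifted bonacci
  recurrence, whose window may start before \<open>j\<close>, but only over zeros.\<close>

lemma fundamental_rec:
  assumes "2 \<le> k" "1 \<le> j" "j < i"
  shows "fundamental k j i = (\<Sum>l = j..<i. gap_weight k i l * fundamental k j l)"
proof (cases "i \<le> k - 1")
  case True
  then show ?thesis using assms
    by (subst sum_gap_weight_init) (auto simp: fundamental_def T_init)
next
  case False
  let ?c = "j - (k - 1)"
  have "T k (min j (k - 1)) (i - ?c) = (\<Sum>l = i - ?c - (k - 1)..<i - ?c. T k (min j (k - 1)) l)"
    using assms False by (intro T_rec) auto
  \<comment> \<open>Since \<open>j < i\<close> and \<open>k - 1 < i\<close>, the window lies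
    strictly above \<open>?c\<close>, so subtracting \<open>?c\<close> truncates nothing.\<close>
  also have "\<dots> = (\<Sum>l = i - (k - 1)..<i. T k (min j (k - 1)) (l - ?c))"
    using assms False
    by (intro sum.reindex_bij_witness[of _ "\<lambda>l. l - ?c" "\<lambda>l. l + ?c"]) auto
  finally have "fundamental k j i = (\<Sum>l = i - (k - 1)..<i. fundamental k j l)"
    by (simp add: fundamental_def)
  also have "\<dots> = (\<Sum>l = j..<i. gap_weight k i l * fundamental k j l)"
    using False assms by (intro sum_gap_weight_step[symmetric] fundamental_before) auto
  finally show ?thesis .
qed

lemma fundamental_pos:
  assumes "2 \<le> k" "1 \<le> j" "j \<le> i"
  shows "0 < fundamental k j i"
  unfolding fundamental_def using assms by (auto intro!: T_pos)

text \<open>The starts \<open>j \<le> k - 1\<close> yield the sequences \<open>T k j\<close>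
  themselves; a start \<open>j = k - 1 + i\<close> yields \<open>T k (k - 1)\<close> delayed by
  \<open>i\<close>.\<close>

lemma prod_fundamental:
  assumes "1 \<le> k" "k \<le> n"
  shows "(\<Prod>j = 1..n. fundamental k j n)
    = (\<Prod>l = 1..k - 1. real (T k l n)) * (\<Prod>i = 1..n - k + 1. real (T k (k - 1) (n - i)))"
proof -
  have "{1..n} = {1..k - 1} \<union> {k..n}" using assms by auto
  then have "(\<Prod>j = 1..n. fundamental k j n) = (\<Prod>j = 1..k - 1. fundamental k j n) * (\<Prod>j = k..n. fundamental k j n)"
    using assms by (simp only:) (intro prod.union_disjoint, auto)
  also have "(\<Prod>j = 1..k - 1. fundamental k j n) = (\<Prod>l = 1..k - 1. real (T k l n))"
    by (intro prod.cong) (auto simp: fundamental_def)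
  also have "(\<Prod>j = k..n. fundamental k j n) = (\<Prod>i = 1..n - k + 1. real (T k (k - 1) (n - i)))"
    using assms
    by (intro prod.reindex_bij_witness[of _ "\<lambda>i. i + (k - 1)" "\<lambda>j. j - (k - 1)"])
       (auto simp: fundamental_def min_def)
  finally show ?thesis .
qed

section \<open>Symmetrization\<close>

text \<open>The rank of an index, the number of entries not exceeding its own, is a permutation when
  the entries are distinct, and its inverse sorts \<open>u\<close>. Outside \<open>{1..n}\<close>
  the rank is set to the identity, as \<open>permutes\<close> demands.\<close>

lemma ex_permutation_strict_sorted:
  fixes u :: "nat \<Rightarrow> real"
  assumes inj: "inj_on u {1..n}"
  shows "\<exists>p. p permutes {1..n} \<and> (\<forall>i\<in>{1..n}. \<forall>j\<in>{1..n}. i < j \<longrightarrow> u (p i) < u (p j))"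
proof -
  define R where "R i = {j \<in> {1..n}. u j \<le> u i}" for i
  define rank where "rank i = (if i \<in> {1..n} then card (R i) else i)" for i
  have fin: "finite (R i)" for i by (simp add: R_def)
  have mono: "card (R i) \<le> card (R j)" if "u i \<le> u j" for i j
    using that fin by (intro card_mono) (auto simp: R_def)
  have inj_rank: "inj_on rank {1..n}"
  proof -
    have *: "u j \<le> u i" if ij: "i \<in> {1..n}" "j \<in> {1..n}" "rank i = rank j" "u i \<le> u j" for i j
    proof -
      have "R i = R j"
        using ij fin by (intro card_subset_eq) (auto simp: R_def rank_def)
      moreover have "j \<in> R j" using ij by (simp add: R_def)
      ultimately have "j \<in> R i" by (simp only:)
      then show ?thesis by (simp add: R_def)
    qed
    show "inj_on rank {1..n}"
    proof (rule inj_onI)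
      fix i j assume ij: "i \<in> {1..n}" "j \<in> {1..n}" "rank i = rank j"
      have "u i = u j" using *[OF ij] *[of j i] ij by (metis linear order_antisym)
      then show "i = j" using inj ij by (auto dest: inj_onD)
    qed
  qed
  have "rank i \<in> {1..n}" if "i \<in> {1..n}" for i
  proof -
    have "card (R i) \<le> card {1..n}" by (intro card_mono) (auto simp: R_def)
    moreover have "0 < card (R i)" using that fin by (auto simp: card_gt_0_iff R_def)
    ultimately show ?thesis using that by (simp add: rank_def)
  qed
  then have "rank ` {1..n} \<subseteq> {1..n}" by blast
  then have "bij_betw rank {1..n} {1..n}"
    using inj_rank endo_inj_surj[of "{1..n}" rank] by (simp add: bij_betw_def)
  then have perm: "rank permutes {1..n}"
    by (intro bij_imp_permutes) (auto simp: rank_def)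
  let ?p = "inv rank"
  have p: "?p permutes {1..n}" using perm by (rule permutes_inv)
  have "u (?p i) < u (?p j)" if ij: "i \<in> {1..n}" "j \<in> {1..n}" "i < j" for i j
  proof (rule ccontr)
    assume "\<not> ?thesis"
    then have "card (R (?p j)) \<le> card (R (?p i))" by (intro mono) simp
    then have "rank (?p j) \<le> rank (?p i)"
      using ij permutes_in_image[OF p] by (simp add: rank_def)
    then show False using ij permutes_inverses(1)[OF perm] by simp
  qed
  then show ?thesis using p by blast
qed

text \<open>The quotient \<open>inv p \<circ> q\<close> is strictly increasing on
  \<open>{1..n}\<close>, hence satisfies \<open>i \<le> s i\<close> there, which forces a
  permutation to be the identity.\<close>

lemma permutation_strict_sorted_unique:
  fixes u :: "nat \<Rightarrow> real"
  assumes p: "p permutes {1..n}" "\<forall>i\<in>{1..n}. \<forall>j\<in>{1..n}. i < j \<longrightarrow> u (p i) < u (p j)"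
    and q: "q permutes {1..n}" "\<forall>i\<in>{1..n}. \<forall>j\<in>{1..n}. i < j \<longrightarrow> u (q i) < u (q j)"
  shows "p = q"
proof -
  define s where "s = inv p \<circ> q"
  have s: "s permutes {1..n}" unfolding s_def by (intro permutes_compose permutes_inv p q)
  have ps: "p (s i) = q i" for i
    using permutes_inverses(1)[OF p(1)] by (simp add: s_def)
  have in_image: "s i \<in> {1..n} \<longleftrightarrow> i \<in> {1..n}" for i by (rule permutes_in_image[OF s])
  have strict: "s i < s j" if "i \<in> {1..n}" "j \<in> {1..n}" "i < j" for i j
  proof (rule ccontr)
    assume "\<not> s i < s j"
    moreover have "s i \<noteq> s j"
      using that permutes_inj[OF s] by (auto dest: injD)
    ultimately have "u (p (s j)) < u (p (s i))"
      using p(2) that in_image by (metis linorder_neqE_nat)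
    moreover have "u (q i) < u (q j)" using q(2) that by blast
    ultimately show False by (simp add: ps)
  qed
  have "i \<le> s i" if "i \<in> {1..n}" for i
    using that
  proof (induction i)
    case (Suc i)
    then show ?case using strict[of i "Suc i"] in_image[of "Suc i"] by (cases "i = 0") auto
  qed simp
  then have "s = id" by (intro permutes_natset_ge[OF s]) auto
  then show "p = q" using ps by (auto simp: fun_eq_iff)
qed

text \<open>By Fubini in coordinate \<open>i\<close>, every section of the set
  \<open>u i = u j\<close> lies in the null set \<open>{u j}\<close>; there are finitely many
  pairs.\<close>

lemma AE_PiM_inj_on:
  fixes N :: "real measure"
  assumes N: "prob_space N" "sets N = sets borel" "\<And>x. emeasure N {x} = 0"
    and "finite I"
  shows "AE u in PiM I (\<lambda>_. N). inj_on u I"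
proof -
  interpret N: prob_space N by fact
  interpret product_prob_space "\<lambda>_. N" I by standard
  have comp: "(\<lambda>x. x i) \<in> borel_measurable (PiM I (\<lambda>_. N))" if "i \<in> I" for i
    using measurable_component_singleton[OF that, of "\<lambda>_. N"] measurable_cong_sets[OF refl N(2)] by blast
  have "AE u in PiM I (\<lambda>_. N). u i \<noteq> u j" if ij: "i \<in> I" "j \<in> I" "i \<noteq> j" for i j
  proof -
    have I: "insert i (I - {i}) = I" using ij by auto
    let ?D = "{u \<in> space (PiM I (\<lambda>_. N)). u i = u j}"
    have D: "?D \<in> sets (PiM I (\<lambda>_. N))"
      using ij by (intro borel_measurable_eq comp)
    have "emeasure (PiM I (\<lambda>_. N)) ?D = (\<integral>\<^sup>+u. indicator ?D u \<partial>PiM I (\<lambda>_. N))"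
      using D by simp
    also have "\<dots> = (\<integral>\<^sup>+u. (\<integral>\<^sup>+y. indicator ?D (u(i := y)) \<partial>N) \<partial>PiM (I - {i}) (\<lambda>_. N))"
      using product_nn_integral_insert[of "I - {i}" i "indicator ?D"] D \<open>finite I\<close> unfolding I by simp
    also have "\<dots> = (\<integral>\<^sup>+u. 0 \<partial>PiM (I - {i}) (\<lambda>_. N))"
    proof (intro nn_integral_cong)
      fix u assume "u \<in> space (PiM (I - {i}) (\<lambda>_. N))"
      have "(\<integral>\<^sup>+y. indicator ?D (u(i := y)) \<partial>N) \<le> (\<integral>\<^sup>+y. indicator {u j} y \<partial>N)"
        using ij by (intro nn_integral_mono) (auto simp: indicator_def)
      also have "\<dots> = 0" using N by simp
      finally show "(\<integral>\<^sup>+y. indicator ?D (u(i := y)) \<partial>N) = 0" by simp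
    qed
    finally have "emeasure (PiM I (\<lambda>_. N)) ?D = 0" by simp
    then show ?thesis using D by (subst AE_iff_measurable[OF D]) auto
  qed
  then have "AE u in PiM I (\<lambda>_. N). \<forall>i\<in>I. \<forall>j\<in>I. i \<noteq> j \<longrightarrow> u i \<noteq> u j"
    using \<open>finite I\<close> by (intro AE_finite_allI) auto
  then show ?thesis by eventually_elim (auto simp: inj_on_def)
qed

lemma pred_sorted:
  fixes n :: nat
  assumes comp: "\<And>i. i \<in> {1..n} \<Longrightarrow> (\<lambda>u. u i :: real) \<in> borel_measurable P"
  shows "Measurable.pred P (\<lambda>u. \<forall>i j. 1 \<le> i \<and> i \<le> j \<and> j \<le> n \<longrightarrow> u i \<le> u j)"
proof -
  have "Measurable.pred P (\<lambda>u. \<forall>i\<in>{1..n}. \<forall>j\<in>{1..n}. i \<le> j \<longrightarrow> u i \<le> u j)"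
  proof (intro pred_intros_finite pred_intros_logic)
    fix i j assume "i \<in> {1..n}" "j \<in> {1..n}"
    then show "Measurable.pred P (\<lambda>u. u i \<le> u j)"
      unfolding pred_def by (intro borel_measurable_le comp)
  qed auto
  also have "(\<lambda>u. \<forall>i\<in>{1..n}. \<forall>j\<in>{1..n}. i \<le> j \<longrightarrow> u i \<le> u j)
      = (\<lambda>u. \<forall>i j. 1 \<le> i \<and> i \<le> j \<and> j \<le> n \<longrightarrow> (u i :: real) \<le> u j)"
  proof (intro ext iffI allI impI ballI)
    fix u :: "nat \<Rightarrow> real" and i j
    assume "\<forall>i\<in>{1..n}. \<forall>j\<in>{1..n}. i \<le> j \<longrightarrow> u i \<le> u j" "1 \<le> i \<and> i \<le> j \<and> j \<le> n"
    then show "u i \<le> u j" by simp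
  qed simp
  finally show ?thesis .
qed

text \<open>Outside the null set of ties, \<open>E\<close> splits into the \<open>n!\<close> pieces
  \<open>D p\<close> according to the permutation that sorts \<open>u\<close>. Permuting coordinates
  preserves the product measure and \<open>E\<close>, so all pieces have the measure of
  \<open>D id\<close>.\<close>

lemma emeasure_PiM_symmetric:
  fixes N :: "real measure"
  assumes N: "prob_space N" "sets N = sets borel" "\<And>x. emeasure N {x} = 0"
    and E: "E \<in> sets (PiM {1..n} (\<lambda>_. N))"
    and invariant: "\<And>p u. p permutes {1..n} \<Longrightarrow> u \<in> space (PiM {1..n} (\<lambda>_. N)) \<Longrightarrow>
        (\<lambda>i\<in>{1..n}. u (p i)) \<in> E \<longleftrightarrow> u \<in> E"
  shows "emeasure (PiM {1..n} (\<lambda>_. N)) E = fact n *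
    emeasure (PiM {1..n} (\<lambda>_. N)) {u \<in> E. \<forall>i j. 1 \<le> i \<and> i \<le> j \<and> j \<le> n \<longrightarrow> u i \<le> u j}"
proof -
  let ?P = "PiM {1..n} (\<lambda>_. N)"
  let ?perms = "{p. p permutes {1..n}}"
  \<comment> \<open>Strict inequalities make the pieces disjoint; the vectors with ties that they
    miss form a null set.\<close>
  define D where "D p = {u \<in> E. \<forall>i\<in>{1..n}. \<forall>j\<in>{1..n}. i < j \<longrightarrow> u (p i) < u (p j)}" for p
  have comp: "(\<lambda>x. x i) \<in> borel_measurable ?P" if "i \<in> {1..n}" for i
    using measurable_component_singleton[OF that, of "\<lambda>_. N"] measurable_cong_sets[OF refl N(2)] by blast
  have sub: "E \<subseteq> space ?P" using E by (rule sets.sets_into_space)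
  have restrict_E: "{u \<in> E. Q u} = E \<inter> {u \<in> space ?P. Q u}" for Q using sub by auto
  have D: "D p \<in> sets ?P" if "p permutes {1..n}" for p
  proof -
    have "Measurable.pred ?P (\<lambda>u. \<forall>i\<in>{1..n}. \<forall>j\<in>{1..n}. i < j \<longrightarrow> u (p i) < u (p j))"
    proof (intro pred_intros_finite pred_intros_logic)
      fix i j assume "i \<in> {1..n}" "j \<in> {1..n}"
      then show "Measurable.pred ?P (\<lambda>u. u (p i) < u (p j))"
        unfolding pred_def using permutes_in_image[OF that] by (intro borel_measurable_less comp) auto
    qed auto
    then show ?thesis unfolding D_def restrict_E pred_def using E by (intro sets.Int)
  qed
  have sorted_meas: "{u \<in> E. \<forall>i j. 1 \<le> i \<and> i \<le> j \<and> j \<le> n \<longrightarrow> u i \<le> u j} \<in> sets ?P"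
    unfolding restrict_E using E pred_sorted[OF comp] unfolding pred_def by (rule sets.Int)
  have inj: "AE u in ?P. inj_on u {1..n}" by (intro AE_PiM_inj_on N) auto
  have D_eq: "emeasure ?P (D p) = emeasure ?P (D id)" if p: "p permutes {1..n}" for p
  proof -
    let ?t = "\<lambda>u. \<lambda>i\<in>{1..n}. u (p i)"
    have "distr ?P ?P ?t = ?P"
      using N(1) permutes_in_image[OF p] permutes_inj_on[OF p] by (intro distr_PiM_reindex) auto
    moreover have t: "?t \<in> measurable ?P ?P"
      using permutes_in_image[OF p] by (intro measurable_restrict measurable_component_singleton) auto
    ultimately have "emeasure ?P (D id) = emeasure ?P (?t -` D id \<inter> space ?P)"
      using emeasure_distr[OF t D[OF permutes_id]] by simp
    also have "?t -` D id \<inter> space ?P = D p"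
      using sub invariant[OF p] by (auto simp: D_def)
    finally show ?thesis by (simp only:)
  qed
  have "emeasure ?P E = emeasure ?P (\<Union>p\<in>?perms. D p)"
  proof (rule emeasure_eq_AE)
    show "AE u in ?P. u \<in> E \<longleftrightarrow> u \<in> (\<Union>p\<in>?perms. D p)"
      using inj by eventually_elim (use ex_permutation_strict_sorted in \<open>auto simp: D_def\<close>)
  qed (use E D finite_permutations in \<open>auto intro!: sets.finite_UN\<close>)
  also have "\<dots> = (\<Sum>p\<in>?perms. emeasure ?P (D p))"
  proof (rule sum_emeasure[symmetric])
    show "disjoint_family_on D ?perms"
      unfolding disjoint_family_on_def D_def using permutation_strict_sorted_unique by blast
  qed (use D finite_permutations in auto)
  also have "\<dots> = (\<Sum>p\<in>?perms. emeasure ?P (D id))"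
    by (intro sum.cong D_eq) auto
  also have "\<dots> = fact n * emeasure ?P (D id)"
  proof -
    have "card ?perms = fact n" by (rule card_permutations) auto
    then show ?thesis by (simp only: sum_constant of_nat_fact)
  qed
  \<comment> \<open>For vectors without ties, weakly and strictly increasing agree.\<close>
  also have "emeasure ?P (D id) = emeasure ?P {u \<in> E. \<forall>i j. 1 \<le> i \<and> i \<le> j \<and> j \<le> n \<longrightarrow> u i \<le> u j}"
  proof (rule emeasure_eq_AE)
    show "AE u in ?P. u \<in> D id \<longleftrightarrow> u \<in> {u \<in> E. \<forall>i j. 1 \<le> i \<and> i \<le> j \<and> j \<le> n \<longrightarrow> u i \<le> u j}"
      using inj
    proof eventually_elim
      case (elim u)
      have "u i < u j" if "u i \<le> u j" "1 \<le> i" "i < j" "j \<le> n" for i j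
        using inj_on_eq_iff[OF elim, of i j] that by (simp add: order_le_less)
      then have "(\<forall>i\<in>{1..n}. \<forall>j\<in>{1..n}. i < j \<longrightarrow> u (id i) < u (id j)) \<longleftrightarrow>
          (\<forall>i j. 1 \<le> i \<and> i \<le> j \<and> j \<le> n \<longrightarrow> u i \<le> u j)" (is "?L \<longleftrightarrow> ?R")
      proof (intro iffI allI ballI impI)
        fix i j assume ?L "1 \<le> i \<and> i \<le> j \<and> j \<le> n"
        then show "u i \<le> u j" by (cases "i = j") (simp_all add: less_imp_le)
      qed simp
      then show ?case unfolding D_def mem_Collect_eq by (rule conj_cong[OF refl])
    qed
  qed (fact D[OF permutes_id] sorted_meas)+
  finally show ?thesis .
qed

section \<open>Uniformly distributed lengths\<close>

text \<open>Both measures agree on rectangles, since \<open>A\<close> and the box have measure 1 and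
  no normalising factor appears. This turns probabilities into Lebesgue volumes inside the
  box.\<close>

lemma PiM_uniform_measure:
  assumes "finite I" and A: "A \<in> sets borel" "emeasure lborel A = 1"
  shows "PiM I (\<lambda>_. uniform_measure lborel A) = uniform_measure (PiM I (\<lambda>_. lborel :: real measure)) (PiE I (\<lambda>_. A))"
proof -
  interpret L: product_sigma_finite "\<lambda>_. lborel :: real measure" by standard
  let ?N = "uniform_measure lborel A :: real measure"
  interpret N: prob_space ?N using A by (intro prob_space_uniform_measure) auto
  interpret product_sigma_finite "\<lambda>_. ?N" by standard
  have box: "PiE I (\<lambda>_. A) \<in> sets (PiM I (\<lambda>_. lborel :: real measure))"
    using A \<open>finite I\<close> by (intro sets_PiM_I_finite) auto
  have box1: "emeasure (PiM I (\<lambda>_. lborel :: real measure)) (PiE I (\<lambda>_. A)) = 1"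
    using A \<open>finite I\<close> by (subst L.emeasure_PiM) auto
  show ?thesis
  proof (rule PiM_eqI[symmetric])
    show "sets (uniform_measure (PiM I (\<lambda>_. lborel)) (PiE I (\<lambda>_. A))) = sets (PiM I (\<lambda>_. ?N))"
      unfolding sets_uniform_measure by (intro sets_PiM_cong) auto
    fix B assume B: "\<And>i. i \<in> I \<Longrightarrow> B i \<in> sets ?N"
    then have "emeasure (uniform_measure (PiM I (\<lambda>_. lborel)) (PiE I (\<lambda>_. A))) (PiE I B)
       = emeasure (PiM I (\<lambda>_. lborel)) (PiE I (\<lambda>i. A \<inter> B i))"
      using box box1 \<open>finite I\<close> sets_PiM_I_finite[of I B "\<lambda>_. lborel"]
      by (subst emeasure_uniform_measure) (auto simp: PiE_Int divide_ennreal_def)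
    also have "\<dots> = (\<Prod>i\<in>I. emeasure lborel (A \<inter> B i))"
      using A B \<open>finite I\<close> by (intro L.emeasure_PiM) auto
    also have "\<dots> = (\<Prod>i\<in>I. emeasure ?N (B i))"
      using A B by (intro prod.cong) (auto simp: divide_ennreal_def)
    finally show "emeasure (uniform_measure (PiM I (\<lambda>_. lborel)) (PiE I (\<lambda>_. A))) (PiE I B)
        = (\<Prod>i\<in>I. emeasure ?N (B i))" .
  qed fact
qed

lemma polygon_constructible_permuteD:
  assumes p: "p permutes {1..n}" and v: "\<And>i. i \<in> {1..n} \<Longrightarrow> v i = u (p i)"
    and "polygon_constructible n k v"
  shows "polygon_constructible n k u"
proof -
  obtain K m where K: "K \<subseteq> {1..n}" "card K = k" "m \<in> K"
    and max: "\<forall>j\<in>K. v j \<le> v m" and less: "v m < sum v (K - {m})"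
    using assms(3) unfolding polygon_constructible_def by blast
  have inj: "inj_on p A" for A using permutes_inj_on[OF p] .
  have vK: "v j = u (p j)" if "j \<in> K" for j using v K that by blast
  have "p ` K - {p m} = p ` (K - {m})" using permutes_inj[OF p] by (auto dest: injD)
  then have "sum u (p ` K - {p m}) = sum v (K - {m})"
    using inj vK by (simp add: sum.reindex)
  moreover have "p ` K \<subseteq> {1..n}" using K permutes_image[OF p] by blast
  moreover have "card (p ` K) = k" using K inj by (simp add: card_image)
  ultimately show ?thesis
    unfolding polygon_constructible_def using K max less vK
    by (intro exI[of _ "p ` K"] conjI bexI[of _ "p m"]) auto
qed

lemma polygon_constructible_permute:
  assumes p: "p permutes {1..n}" and v: "\<And>i. i \<in> {1..n} \<Longrightarrow> v i = u (p i)"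
  shows "polygon_constructible n k v \<longleftrightarrow> polygon_constructible n k u"
proof
  assume "polygon_constructible n k u"
  moreover have "u i = v (inv p i)" if "i \<in> {1..n}" for i
    using v[of "inv p i"] that permutes_in_image[OF permutes_inv[OF p]] permutes_inverses(1)[OF p] by simp
  ultimately show "polygon_constructible n k v"
    using polygon_constructible_permuteD[OF permutes_inv[OF p]] by blast
qed (use polygon_constructible_permuteD[OF p] v in blast)

lemma pred_polygon_constructible:
  assumes comp: "\<And>i. i \<in> {1..n} \<Longrightarrow> (\<lambda>u. u i) \<in> borel_measurable P"
  shows "Measurable.pred P (polygon_constructible n k)"
proof -
  have "Measurable.pred P (\<lambda>u. \<exists>K\<in>{K \<in> Pow {1..n}. card K = k}. \<exists>m\<in>K.
      (\<forall>j\<in>K. u j \<le> u m) \<and> u m < (\<Sum>j\<in>K - {m}. u j))"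
  proof (intro pred_intros_finite pred_intros_logic)
    fix K m assume K: "K \<in> {K \<in> Pow {1..n}. card K = k}" "m \<in> K"
    then have m: "m \<in> {1..n}" by auto
    show "Measurable.pred P (\<lambda>u. u m < (\<Sum>j\<in>K - {m}. u j))"
      unfolding pred_def using K m by (intro borel_measurable_less borel_measurable_sum comp) auto
    fix j assume "j \<in> K"
    then show "Measurable.pred P (\<lambda>u. u j \<le> u m)"
      unfolding pred_def using K m by (intro borel_measurable_le comp) auto
  qed (auto intro: finite_subset)
  also have "(\<lambda>u. \<exists>K\<in>{K \<in> Pow {1..n}. card K = k}. \<exists>m\<in>K.
      (\<forall>j\<in>K. u j \<le> u m) \<and> u m < (\<Sum>j\<in>K - {m}. u j)) = polygon_constructible n k"
    by (auto simp: fun_eq_iff polygon_constructible_def)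
  finally show ?thesis .
qed

text \<open>The cone integral with linear form \<open>x n\<close>, \<open>r = 0\<close> and
  \<open>c = 1\<close>: then \<open>trunc_power 0 (1 - x n)\<close> is the indicator of
  \<open>x n \<le> 1\<close>, and the result contains
  \<open>trunc_power n 1 = 1 / fact n\<close>.\<close>

lemma emeasure_gap_cone:
  assumes "3 \<le> k" "1 \<le> n"
  shows "emeasure (PiM {1..n} (\<lambda>_. lborel))
      {x \<in> space (PiM {1..n} (\<lambda>_. lborel)). (\<forall>i\<in>{1..n}. (\<Sum>l = 1..<i. gap_weight k i l * x l) \<le> x i) \<and> x n \<le> 1}
    = ennreal (1 / (fact n * (\<Prod>j = 1..n. fundamental k j n)))"
proof -
  let ?P = "PiM {1..n} (\<lambda>_. lborel :: real measure)"
  let ?C = "{x \<in> space ?P. (\<forall>i\<in>{1..n}. (\<Sum>l = 1..<i. gap_weight k i l * x l) \<le> x i) \<and> x n \<le> 1}"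
  define a :: "nat \<Rightarrow> real" where "a i = (if i = n then 1 else 0)" for i
  have a_sum: "(\<Sum>i = j..n. a i * x i) = x n" if "j \<le> n" for j and x :: "nat \<Rightarrow> real"
  proof -
    have "(\<Sum>i = j..n. a i * x i) = (\<Sum>i\<in>{n}. a i * x i)"
      using that by (intro sum.mono_neutral_right) (auto simp: a_def)
    then show ?thesis by (simp add: a_def)
  qed
  let ?f = "\<lambda>x. ennreal (trunc_power 0 (1 - (\<Sum>i = 1..n. a i * x i))) *
             indicator {x. \<forall>i\<in>{1..n}. (\<Sum>l = 1..<i. gap_weight k i l * x l) \<le> x i} x"
  have f: "?f x = indicator ?C x" if "x \<in> space ?P" for x
    using that assms by (auto simp: a_sum trunc_power_def indicator_def)
  have "(indicator ?C :: _ \<Rightarrow> ennreal) \<in> borel_measurable ?P"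
    using measurable_cone_integrand by (subst measurable_cong[OF f[symmetric]])
  then have "?C \<inter> space ?P \<in> sets ?P"
    by (subst (asm) borel_measurable_indicator_iff)
  moreover have "?C \<inter> space ?P = ?C" by blast
  ultimately have "?C \<in> sets ?P" by (simp only:)
  then have "emeasure ?P ?C = (\<integral>\<^sup>+x. indicator ?C x \<partial>?P)" by simp
  also have "\<dots> = (\<integral>\<^sup>+x. ?f x \<partial>?P)" by (intro nn_integral_cong f[symmetric])
  also have "\<dots> = ennreal (trunc_power (0 + n) 1 / (\<Prod>j = 1..n. \<Sum>i = j..n. a i * fundamental k j i))"
    using assms
    by (intro nn_integral_cone fundamental_diag fundamental_rec) (auto simp: a_sum fundamental_pos)
  also have "(\<Prod>j = 1..n. \<Sum>i = j..n. a i * fundamental k j i) = (\<Prod>j = 1..n. fundamental k j n)"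
    by (intro prod.cong) (auto simp: a_sum)
  finally show ?thesis by (simp add: trunc_power_def)
qed

text \<open>The factor \<open>fact n\<close> from symmetrization cancels the one in the volume of
  the truncated cone.\<close>

lemma emeasure_no_polygon:
  defines "N \<equiv> uniform_measure lborel {0..1::real}"
  assumes "3 \<le> k" "k \<le> n"
  shows "emeasure (PiM {1..n} (\<lambda>_. N)) {u \<in> space (PiM {1..n} (\<lambda>_. N)). \<not> polygon_constructible n k u}
    = ennreal (1 / (\<Prod>j = 1..n. fundamental k j n))"
proof -
  let ?P = "PiM {1..n} (\<lambda>_. N)" and ?L = "PiM {1..n} (\<lambda>_. lborel :: real measure)"
  let ?E = "{u \<in> space ?P. \<not> polygon_constructible n k u}"
  let ?S = "{u \<in> ?E. \<forall>i j. 1 \<le> i \<and> i \<le> j \<and> j \<le> n \<longrightarrow> u i \<le> u j}"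
  let ?box = "PiE {1..n} (\<lambda>_. {0..1::real})"
  let ?C = "{x \<in> space ?L. (\<forall>i\<in>{1..n}. (\<Sum>l = 1..<i. gap_weight k i l * x l) \<le> x i) \<and> x n \<le> 1}"
  have N: "prob_space N" "sets N = sets borel" "\<And>x. emeasure N {x} = 0"
    by (auto simp: N_def Int_insert_right intro!: prob_space_uniform_measure)
  have P_eq: "?P = uniform_measure ?L ?box"
    unfolding N_def by (intro PiM_uniform_measure) auto
  have spaces: "space ?P = PiE {1..n} (\<lambda>_. UNIV)" "space ?L = PiE {1..n} (\<lambda>_. UNIV)"
    by (auto simp: space_PiM N_def)
  have comp: "(\<lambda>x. x i) \<in> borel_measurable ?P" if "i \<in> {1..n}" for i
    using measurable_component_singleton[OF that, of "\<lambda>_. N"] measurable_cong_sets[OF refl N(2)] by blast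
  have E: "?E \<in> sets ?P"
    using pred_intros_logic(2)[OF pred_polygon_constructible[OF comp]] unfolding pred_def .
  interpret L: product_sigma_finite "\<lambda>_. lborel :: real measure" by standard
  have box: "?box \<in> sets ?L" "emeasure ?L ?box = 1"
    by (auto intro!: sets_PiM_I_finite simp: L.emeasure_PiM)
  have S: "?S \<in> sets ?L"
  proof -
    have "?S = ?E \<inter> {u \<in> space ?P. \<forall>i j. 1 \<le> i \<and> i \<le> j \<and> j \<le> n \<longrightarrow> u i \<le> u j}" by blast
    also have "\<dots> \<in> sets ?P" using E pred_sorted[OF comp] unfolding pred_def by (rule sets.Int)
    also have "sets ?P = sets ?L" using P_eq by simp
    finally show ?thesis .
  qed
  have "emeasure ?P ?E = fact n * emeasure ?P ?S"
    using N E
  proof (rule emeasure_PiM_symmetric)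
    fix p u assume p: "p permutes {1..n}" and "u \<in> space ?P"
    then have "u \<in> PiE {1..n} (\<lambda>_. UNIV)" by (simp only: spaces)
    moreover have "polygon_constructible n k (\<lambda>i\<in>{1..n}. u (p i)) \<longleftrightarrow> polygon_constructible n k u"
      by (rule polygon_constructible_permute[OF p]) simp
    ultimately show "(\<lambda>i\<in>{1..n}. u (p i)) \<in> ?E \<longleftrightarrow> u \<in> ?E"
      unfolding spaces by simp
  qed
  \<comment> \<open>The box has Lebesgue measure 1, so conditioning on it is mere
    intersection.\<close>
  also have "emeasure ?P ?S = emeasure ?L (?box \<inter> ?S)"
    unfolding P_eq[symmetric] using box S by (subst P_eq) (simp add: emeasure_uniform_measure divide_ennreal_def)
  also have "?box \<inter> ?S = ?C"
  proof -
    have "x \<in> ?box \<inter> ?S \<longleftrightarrow> x \<in> ?C" for x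
    proof -
      have "x \<in> ?box \<longleftrightarrow> x \<in> PiE {1..n} (\<lambda>_. UNIV) \<and> (\<forall>i\<in>{1..n}. x i \<in> {0..1})"
        unfolding PiE_iff by blast
      then have "x \<in> ?box \<inter> ?S \<longleftrightarrow> x \<in> PiE {1..n} (\<lambda>_. UNIV) \<and>
          ((\<forall>i\<in>{1..n}. x i \<in> {0..1}) \<and> (\<forall>i j. 1 \<le> i \<and> i \<le> j \<and> j \<le> n \<longrightarrow> x i \<le> x j) \<and>
            \<not> polygon_constructible n k x)"
        unfolding spaces Int_iff mem_Collect_eq by argo
      also have "\<dots> \<longleftrightarrow> x \<in> ?C"
        using assms by (subst sorted_not_polygon_iff) (simp_all only: spaces mem_Collect_eq)
      finally show ?thesis .
    qed
    then show ?thesis by (rule set_eqI)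
  qed
  also have "emeasure ?L ?C = ennreal (1 / (fact n * (\<Prod>j = 1..n. fundamental k j n)))"
    using assms by (intro emeasure_gap_cone) auto
  also have "fact n * \<dots> = ennreal (fact n) * \<dots>"
    using ennreal_of_nat_eq_real_of_nat[of "fact n"] by simp
  also have "\<dots> = ennreal (fact n * (1 / (fact n * (\<Prod>j = 1..n. fundamental k j n))))"
    by (rule ennreal_mult'[symmetric]) simp
  also have "fact n * (1 / (fact n * (\<Prod>j = 1..n. fundamental k j n))) = 1 / (\<Prod>j = 1..n. fundamental k j n)"
    by simp
  finally show ?thesis .
qed

theorem mainTheorem1:
  fixes M :: "'a measure" and U :: "nat \<Rightarrow> 'a \<Rightarrow> real" and n k :: nat
  assumes "n \<ge> 3" and "3 \<le> k" and "k \<le> n"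
    and "prob_space M"
    and "prob_space.indep_vars M (\<lambda>_. borel) U {1..n}"
    and "\<And>i. i \<in> {1..n} \<Longrightarrow> distr M borel (U i) = uniform_measure lborel {0..1}"
  shows "measure M {\<omega> \<in> space M. \<not> polygon_constructible n k (\<lambda>i. U i \<omega>)} =
           1 / ((\<Prod>l = 1..k - 1. real (T k l n)) * (\<Prod>i = 1..n - k + 1. real (T k (k - 1) (n - i))))
       \<and> measure M {\<omega> \<in> space M. \<not> polygon_constructible n k (\<lambda>i. U i \<omega>)} =
           1 / ((\<Prod>l = 1..k - 3. real (T k l n)) * (\<Prod>i = 1..n - k + 3. real (S k i)))"
proof -
  interpret prob_space M by fact
  define N where "N = uniform_measure lborel {0..1::real}"
  let ?P = "PiM {1..n} (\<lambda>_. N)" and ?B = "PiM {1..n} (\<lambda>_. borel :: real measure)"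
  let ?E = "{u \<in> space ?P. \<not> polygon_constructible n k u}"
  let ?X = "\<lambda>\<omega>. \<lambda>i\<in>{1..n}. U i \<omega>"
  have rv: "random_variable borel (U i)" if "i \<in> {1..n}" for i
    using assms(5) that by (simp add: indep_vars_def)
  \<comment> \<open>Independence makes the joint law of the lengths the product of their marginal
    laws.\<close>
  have "distr M ?B ?X = PiM {1..n} (\<lambda>i. distr M borel (U i))"
    using assms(1,5) rv by (subst (asm) indep_vars_iff_distr_eq_PiM') auto
  also have "\<dots> = ?P"
    using assms(6) by (intro PiM_cong) (auto simp: N_def)
  finally have distr: "distr M ?B ?X = ?P" .
  have X: "?X \<in> measurable M ?B" by (intro measurable_restrict rv)
  have comp: "(\<lambda>x. x i) \<in> borel_measurable ?B" if "i \<in> {1..n}" for i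
    using that by (rule measurable_component_singleton)
  have E: "?E \<in> sets ?B"
    using pred_intros_logic(2)[OF pred_polygon_constructible[OF comp, of n k]] unfolding pred_def
    by (simp add: space_PiM N_def)
  have "measure M {\<omega> \<in> space M. \<not> polygon_constructible n k (\<lambda>i. U i \<omega>)} = measure ?P ?E"
  proof -
    \<comment> \<open>The identity permutation shows that only the values on \<open>{1..n}\<close>
      count, so restricting the family to them is harmless.\<close>
    have "polygon_constructible n k (?X \<omega>) \<longleftrightarrow> polygon_constructible n k (\<lambda>i. U i \<omega>)" for \<omega>
      by (rule polygon_constructible_permute[OF permutes_id]) simp
    then have "?X -` ?E \<inter> space M = {\<omega> \<in> space M. \<not> polygon_constructible n k (\<lambda>i. U i \<omega>)}"
      by (auto simp: space_PiM N_def)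
    then show ?thesis using measure_distr[OF X E] unfolding distr by simp
  qed
  also have "\<dots> = 1 / (\<Prod>j = 1..n. fundamental k j n)"
  proof -
    \<comment> \<open>Nonnegativity lets the \<open>ennreal\<close> value be read back as the same
      real number.\<close>
    have "0 \<le> (\<Prod>j = 1..n. fundamental k j n)" by (simp add: fundamental_def prod_nonneg)
    then show ?thesis
      using emeasure_no_polygon[OF assms(2,3)] by (simp add: measure_def N_def)
  qed
  finally have prob: "measure M {\<omega> \<in> space M. \<not> polygon_constructible n k (\<lambda>i. U i \<omega>)}
      = 1 / (\<Prod>j = 1..n. fundamental k j n)" .
  have "(\<Prod>l = 1..k - 1. real (T k l n)) * (\<Prod>i = 1..n - k + 1. real (T k (k - 1) (n - i)))
      = (\<Prod>l = 1..k - 3. real (T k l n)) * (\<Prod>i = 1..n - k + 3. real (S k i))"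
    using arg_cong[OF prod_T_eq_prod_S[OF assms(2,3)], of real] by simp
  moreover have "(\<Prod>j = 1..n. fundamental k j n)
      = (\<Prod>l = 1..k - 1. real (T k l n)) * (\<Prod>i = 1..n - k + 1. real (T k (k - 1) (n - i)))"
    using assms by (intro prod_fundamental) auto
  ultimately show ?thesis using prob by (simp only: simp_thms)
qed

end
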